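(* Let $\eta$ be a non-periodic Toeplitz sequence with period structure $(p_n)_{n\ge1}$. Assume that for all $k\in\mathbb Z\setminus\{0\}$ the set $\partial W\cap(\partial W-\Delta(k))$ is nowhere dense with respect to the subspace topology of $\partial W$. Let the automorphism $F$ of $(X_\eta,\sigma)$ be described by a block code $\{0,1\}^{[-m:m]}\to\{0,1\}$. Then $$\partial W+y_F\subseteq\bigcup_{k=-m}^m\bigl(\partial W+\Delta(k)\bigr).$$
   Context: A non-periodic Toeplitz sequence with period structure $p_1\mid p_2\mid\dots\to\infty$ is a non-periodic $\eta\in\{0,1\}^{\mathbb Z}$ such that for each $k\in\mathbb Z$ there is $n\ge1$ with $\eta|_{k+p_n\mathbb Z}$ constant. $\sigma$ is the left shift and $X_\eta$ the orbit closure of $\eta$. For $i=0,1$: $\mathcal P_n^i=\{k\in\mathbb Z:\eta|_{k+p_n\mathbb Z}=i\}$. $G=\varprojlim\mathbb Z/p_n\mathbb Z$; $\Delta(k)=(k+p_n\mathbb Z)_n$; $Tg=g+\Delta(1)$; $U_n(h)=\{g\in G:g_n=h_n\}$; $V^i=\bigcup_{n}\bigcup_{k\in\mathcal P_n^i\cap[0,p_n)}U_n(\Delta(k))$; $W=\overline{V^1}=G\setminus V^0$ with boundary $\partial W=G\setminus(V^0\cup V^1)$. Standing assumption: $(G,T)$ is the maximal equicontinuous factor of $(X_\eta,\sigma)$, with factor map $\pi$ determined by $\pi(\eta)=\Delta(0)$. An automorphism is a homeomorphism $F$ of $X_\eta$ commuting with $\sigma$; $y_F\in G$ is the unique element with $\pi(F(x))=\pi(x)+y_F$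 for all $x\in X_\eta$. $F$ is described by a block code $c:\{0,1\}^{[-m:m]}\to\{0,1\}$ if $(Fx)_s=c(x_{s-m},\dots,x_{s+m})$ for all $x\in X_\eta$, $s\in\mathbb Z$. *)

theory Defs
  imports "HOL-Analysis.Analysis"
begin

section \<open>Topological dynamics\<close>

definition factor_map ::
    "'a topology \<Rightarrow> ('a \<Rightarrow> 'a) \<Rightarrow> 'b topology \<Rightarrow> ('b \<Rightarrow> 'b) \<Rightarrow> ('a \<Rightarrow> 'b) \<Rightarrow> bool" where
  "factor_map X S Y R \<phi> \<longleftrightarrow>
     continuous_map X Y \<phi> \<and> \<phi> ` topspace X = topspace Y \<and>
     (\<forall>x\<in>topspace X. \<phi> (S x) = R (\<phi> x))"

text \<open>Since \<open>Y\<close> is compact, the choice of the metric inducing its topology is irrelevant.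
  Both conjuncts are needed to cover all iterates \<open>R\<^sup>n\<close> with \<open>n \<in> \<int>\<close>.\<close>

definition equicontinuous_system :: "'a topology \<Rightarrow> ('a \<Rightarrow> 'a) \<Rightarrow> bool" where
  "equicontinuous_system Y R \<longleftrightarrow>
     compact_space Y \<and> homeomorphic_map Y Y R \<and>
     (\<exists>d. Metric_space (topspace Y) d \<and> Metric_space.mtopology (topspace Y) d = Y \<and>
        (\<forall>\<epsilon>>0. \<exists>\<delta>>0. \<forall>x\<in>topspace Y. \<forall>y\<in>topspace Y. d x y < \<delta> \<longrightarrow>
           (\<forall>n::nat. d ((R ^^ n) x) ((R ^^ n) y) < \<epsilon> \<and>
              d ((inv_into (topspace Y) R ^^ n) x) ((inv_into (topspace Y) R ^^ n) y) < \<epsilon>)))"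

text \<open>The competing equicontinuous factors range over topologies on the point type of \<open>X\<close>.
  This is no restriction: the underlying set of a factor of \<open>X\<close> injects into \<open>topspace X\<close>,
  so every factor has an isomorphic copy whose points are of that type.\<close>

definition maximal_equicontinuous_factor ::
    "'a topology \<Rightarrow> ('a \<Rightarrow> 'a) \<Rightarrow> 'b topology \<Rightarrow> ('b \<Rightarrow> 'b) \<Rightarrow> ('a \<Rightarrow> 'b) \<Rightarrow> bool" where
  "maximal_equicontinuous_factor X S G T \<pi> \<longleftrightarrow>
     equicontinuous_system G T \<and> factor_map X S G T \<pi> \<and>
     (\<forall>(Y::'a topology) R \<phi>. equicontinuous_system Y R \<and> factor_map X S Y R \<phi> \<longrightarrow>
        (\<exists>\<psi>. factor_map G T Y R \<psi> \<and> (\<forall>x\<in>topspace X. \<phi> x = \<psi> (\<pi> x))))"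

definition nowhere_dense_in :: "'a topology \<Rightarrow> 'a set \<Rightarrow> bool" where
  "nowhere_dense_in X A \<longleftrightarrow> X interior_of (X closure_of A) = {}"


section \<open>Toeplitz sequences and their orbit closures\<close>

text \<open>The alphabet \<open>{0,1}\<close> is \<^typ>\<open>bool\<close>, with \<^term>\<open>True\<close> for \<open>1\<close>.
  Period structures are indexed from \<open>0\<close>: \<open>p 0\<close>, \<open>p 1\<close>, ... are \<open>p\<^sub>1\<close>, \<open>p\<^sub>2\<close>, ...\<close>

definition period_structure :: "(nat \<Rightarrow> nat) \<Rightarrow> bool" where
  "period_structure p \<longleftrightarrow>
     (\<forall>n. 0 < p n) \<and> (\<forall>n. p n dvd p (Suc n)) \<and> filterlim p at_top sequentially"

definition nonperiodic :: "(int \<Rightarrow> bool) \<Rightarrow> bool" where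
  "nonperiodic \<eta> \<longleftrightarrow> \<not> (\<exists>q>0. \<forall>k. \<eta> (k + q) = \<eta> k)"

definition nonperiodic_Toeplitz :: "(nat \<Rightarrow> nat) \<Rightarrow> (int \<Rightarrow> bool) \<Rightarrow> bool" where
  "nonperiodic_Toeplitz p \<eta> \<longleftrightarrow>
     period_structure p \<and> nonperiodic \<eta> \<and>
     (\<forall>k. \<exists>n. \<forall>j. \<eta> (k + int (p n) * j) = \<eta> k)"

definition full_shift :: "(int \<Rightarrow> bool) topology" where
  "full_shift = product_topology (\<lambda>_. discrete_topology UNIV) UNIV"

definition shift :: "(int \<Rightarrow> bool) \<Rightarrow> (int \<Rightarrow> bool)" where
  "shift x = (\<lambda>k. x (k + 1))"

definition orbit_closure :: "(int \<Rightarrow> bool) \<Rightarrow> (int \<Rightarrow> bool) topology" where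
  "orbit_closure \<eta> =
     subtopology full_shift (full_shift closure_of range (\<lambda>n::int. \<lambda>k. \<eta> (k + n)))"

definition automorphism :: "(int \<Rightarrow> bool) \<Rightarrow> ((int \<Rightarrow> bool) \<Rightarrow> (int \<Rightarrow> bool)) \<Rightarrow> bool" where
  "automorphism \<eta> F \<longleftrightarrow>
     homeomorphic_map (orbit_closure \<eta>) (orbit_closure \<eta>) F \<and>
     (\<forall>x\<in>topspace (orbit_closure \<eta>). F (shift x) = shift (F x))"

text \<open>A block in \<open>{0,1}\<close> to the power \<open>[-m:m]\<close> is a function that is extensional on
  \<open>{-m..m}\<close>, so the values of \<open>c\<close> on other functions play no role.\<close>

definition described_by_block_code ::
    "(int \<Rightarrow> bool) \<Rightarrow> ((int \<Rightarrow> bool) \<Rightarrow> (int \<Rightarrow> bool)) \<Rightarrow> nat \<Rightarrow> ((int \<Rightarrow> bool) \<Rightarrow> bool) \<Rightarrow> bool" where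
  "described_by_block_code \<eta> F m c \<longleftrightarrow>
     (\<forall>x\<in>topspace (orbit_closure \<eta>). \<forall>s.
        F x s = c (restrict (\<lambda>i. x (s + i)) {- int m..int m}))"


section \<open>The odometer\<close>

text \<open>\<open>\<int>/p\<^sub>n\<int>\<close> is represented by the residues \<open>0, ..., p\<^sub>n - 1\<close>.\<close>

definition odometer :: "(nat \<Rightarrow> nat) \<Rightarrow> (nat \<Rightarrow> int) topology" where
  "odometer p =
     subtopology (product_topology (\<lambda>n. discrete_topology {0..<int (p n)}) UNIV)
       {g. \<forall>n. g (Suc n) mod int (p n) = g n}"

definition od_add :: "(nat \<Rightarrow> nat) \<Rightarrow> (nat \<Rightarrow> int) \<Rightarrow> (nat \<Rightarrow> int) \<Rightarrow> (nat \<Rightarrow> int)" where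
  "od_add p g h = (\<lambda>n. (g n + h n) mod int (p n))"

definition od_diff :: "(nat \<Rightarrow> nat) \<Rightarrow> (nat \<Rightarrow> int) \<Rightarrow> (nat \<Rightarrow> int) \<Rightarrow> (nat \<Rightarrow> int)" where
  "od_diff p g h = (\<lambda>n. (g n - h n) mod int (p n))"

definition Delta :: "(nat \<Rightarrow> nat) \<Rightarrow> int \<Rightarrow> (nat \<Rightarrow> int)" where
  "Delta p k = (\<lambda>n. k mod int (p n))"

definition od_rotation :: "(nat \<Rightarrow> nat) \<Rightarrow> (nat \<Rightarrow> int) \<Rightarrow> (nat \<Rightarrow> int)" where
  "od_rotation p g = od_add p g (Delta p 1)"

definition cylinder :: "(nat \<Rightarrow> nat) \<Rightarrow> nat \<Rightarrow> (nat \<Rightarrow> int) \<Rightarrow> (nat \<Rightarrow> int) set" where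
  "cylinder p n h = {g \<in> topspace (odometer p). g n = h n}"

definition per_positions :: "(nat \<Rightarrow> nat) \<Rightarrow> (int \<Rightarrow> bool) \<Rightarrow> nat \<Rightarrow> bool \<Rightarrow> int set" where
  "per_positions p \<eta> n i = {k. \<forall>j. \<eta> (k + int (p n) * j) = i}"

definition V :: "(nat \<Rightarrow> nat) \<Rightarrow> (int \<Rightarrow> bool) \<Rightarrow> bool \<Rightarrow> (nat \<Rightarrow> int) set" where
  "V p \<eta> i =
     (\<Union>n. \<Union>k\<in>per_positions p \<eta> n i \<inter> {0..<int (p n)}. cylinder p n (Delta p k))"

definition W :: "(nat \<Rightarrow> nat) \<Rightarrow> (int \<Rightarrow> bool) \<Rightarrow> (nat \<Rightarrow> int) set" where
  "W p \<eta> = odometer p closure_of V p \<eta> True"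

definition bdW :: "(nat \<Rightarrow> nat) \<Rightarrow> (int \<Rightarrow> bool) \<Rightarrow> (nat \<Rightarrow> int) set" where
  "bdW p \<eta> = odometer p frontier_of W p \<eta>"

definition y_of ::
    "(nat \<Rightarrow> nat) \<Rightarrow> (int \<Rightarrow> bool) \<Rightarrow> ((int \<Rightarrow> bool) \<Rightarrow> (nat \<Rightarrow> int)) \<Rightarrow>
     ((int \<Rightarrow> bool) \<Rightarrow> (int \<Rightarrow> bool)) \<Rightarrow> (nat \<Rightarrow> int)" where
  "y_of p \<eta> \<pi> F =
     (THE y. y \<in> topspace (odometer p) \<and>
        (\<forall>x\<in>topspace (orbit_closure \<eta>). \<pi> (F x) = od_add p (\<pi> x) y))"

end

theory Submission
  imports Defs
begin

text \<open>If \<open>g + \<Delta>(k)\<close> avoids \<open>\<partial>W\<close> for all \<open>\<bar>k\<bar> \<le> m\<close>, then the \<open>m\<close>-blocks of all points in the fibres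
  near \<open>g\<close> agree, so \<open>F\<close> is constant at position \<open>0\<close> on these fibres and \<open>g + y\<^sub>F \<notin> \<partial>W\<close>. This is
  the required inclusion for \<open>F\<inverse>\<close>. For \<open>F\<close> itself, injectivity of \<open>F\<close> still gives that every
  \<open>g \<in> \<partial>W\<close> has \<open>g + y\<^sub>F \<in> \<partial>W + \<Delta>(k)\<close> for some \<open>k\<close>, as the fibre over \<open>g\<close> is not a singleton. If
  \<open>\<bar>k\<bar> > m\<close>, the first inclusion, applied at \<open>g - \<Delta>(k)\<close>, puts \<open>g\<close> into \<open>\<partial>W \<inter> (\<partial>W - \<Delta>(l))\<close> for some
  \<open>l \<noteq> 0\<close>. So the points of \<open>\<partial>W\<close> violating the claim form an open subset of \<open>\<partial>W\<close> covered by
  countably many nowhere dense sets, which is empty by Baire's theorem.\<close>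

section \<open>The odometer\<close>

lemma topspace_odometer_iff:
  "g \<in> topspace (odometer p) \<longleftrightarrow>
    (\<forall>n. 0 \<le> g n \<and> g n < int (p n) \<and> g (Suc n) mod int (p n) = g n)"
  by (auto simp: odometer_def PiE_iff)

locale odometer_system =
  fixes p :: "nat \<Rightarrow> nat"
  assumes period_structure: "period_structure p"
begin

abbreviation G where "G \<equiv> odometer p"

definition translate :: "int \<Rightarrow> (nat \<Rightarrow> int) \<Rightarrow> (nat \<Rightarrow> int)" where
  "translate k g = od_add p g (Delta p k)"

section \<open>Arithmetic of compatible residue sequences\<close>

lemma period_pos: "0 < int (p n)"
  using period_structure by (auto simp: period_structure_def)

lemma period_dvd: "i \<le> n \<Longrightarrow> int (p i) dvd int (p n)"
proof (induction n rule: dec_induct)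
  case (step n)
  have "int (p n) dvd int (p (Suc n))"
    using period_structure by (simp add: period_structure_def)
  with step.IH show ?case by (rule dvd_trans)
qed simp

lemma odometer_mod:
  assumes "g \<in> topspace G" "i \<le> n"
  shows "g n mod int (p i) = g i"
  using assms(2)
proof (induction n rule: dec_induct)
  case base
  then show ?case using assms(1) by (simp add: topspace_odometer_iff)
next
  case (step n)
  then show ?case
    using assms(1) mod_mod_cancel[OF period_dvd[of i n], of "g (Suc n)"]
    by (simp add: topspace_odometer_iff)
qed

lemma odometer_mod_self: "g \<in> topspace G \<Longrightarrow> g n mod int (p n) = g n"
  by (rule odometer_mod) simp_all

lemma odometer_mod_Suc: "g \<in> topspace G \<Longrightarrow> g (Suc n) mod int (p n) = g n mod int (p n)"
  by (simp add: odometer_mod odometer_mod_self)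

text \<open>The representatives \<open>f n\<close> may be unreduced, which is the form in which sums
  and differences of residues arise.\<close>

lemma odometerI:
  assumes "\<And>n. g n = f n mod int (p n)" "\<And>n. f (Suc n) mod int (p n) = f n mod int (p n)"
  shows "g \<in> topspace G"
proof -
  have "g (Suc n) mod int (p n) = g n" for n
    unfolding assms(1) using period_dvd[of n "Suc n"] by (simp add: mod_mod_cancel assms(2))
  then show ?thesis
    using period_pos by (simp add: topspace_odometer_iff) (simp add: assms(1))
qed

lemma Delta_in: "Delta p k \<in> topspace G"
  by (rule odometerI[where f="\<lambda>_. k"]) (auto simp: Delta_def)

lemma add_in:
  assumes "g \<in> topspace G" "h \<in> topspace G"
  shows "od_add p g h \<in> topspace G"
proof (rule odometerI[where f="\<lambda>n. g n + h n"])
  fix n show "(g (Suc n) + h (Suc n)) mod int (p n) = (g n + h n) mod int (p n)"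
    using assms odometer_mod_Suc by (intro mod_add_cong) auto
qed (simp add: od_add_def)

lemma diff_in:
  assumes "g \<in> topspace G" "h \<in> topspace G"
  shows "od_diff p g h \<in> topspace G"
proof (rule odometerI[where f="\<lambda>n. g n - h n"])
  fix n show "(g (Suc n) - h (Suc n)) mod int (p n) = (g n - h n) mod int (p n)"
    using assms odometer_mod_Suc by (intro mod_diff_cong) auto
qed (simp add: od_diff_def)

lemma translate_in: "g \<in> topspace G \<Longrightarrow> translate k g \<in> topspace G"
  by (simp add: translate_def add_in Delta_in)

lemma translate_translate: "translate j (translate k g) = translate (j + k) g"
  by (simp add: translate_def od_add_def Delta_def mod_simps) (simp add: ac_simps)

lemma translate_add: "translate k (od_add p g h) = od_add p (translate k g) h"
  by (simp add: translate_def od_add_def Delta_def mod_simps) (simp add: ac_simps)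

lemma translate_0: "g \<in> topspace G \<Longrightarrow> translate 0 g = g"
  by (simp add: translate_def od_add_def Delta_def odometer_mod_self)

lemma diff_Delta: "od_diff p g (Delta p k) = translate (- k) g"
  by (simp add: translate_def od_diff_def od_add_def Delta_def mod_simps)

lemma diff_add: "g \<in> topspace G \<Longrightarrow> od_diff p (od_add p g h) h = g"
  by (simp add: od_diff_def od_add_def mod_simps odometer_mod_self)

lemma add_diff: "g \<in> topspace G \<Longrightarrow> od_add p (od_diff p g h) h = g"
  by (simp add: od_diff_def od_add_def mod_simps odometer_mod_self)

section \<open>Cylinders as a neighbourhood base of the odometer\<close>

lemma cylinder_mono:
  assumes "g \<in> topspace G" "i \<le> n"
  shows "cylinder p n g \<subseteq> cylinder p i g"
proof
  fix h assume h: "h \<in> cylinder p n g"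
  then have "h i = h n mod int (p i)" "g i = g n mod int (p i)"
    using assms odometer_mod[of h i n] odometer_mod[of g i n] by (auto simp: cylinder_def)
  then show "h \<in> cylinder p i g" using h by (simp add: cylinder_def)
qed

lemma openin_coordinate: "openin G {g \<in> topspace G. g n = a}"
proof -
  have "continuous_map G (discrete_topology {0..<int (p n)}) (\<lambda>g. g n)"
    unfolding odometer_def by (intro continuous_intros) auto
  then have "openin G {g \<in> topspace G. g n \<in> {a} \<inter> {0..<int (p n)}}"
    by (rule openin_continuous_map_preimage) simp
  moreover have "{g \<in> topspace G. g n \<in> {a} \<inter> {0..<int (p n)}} = {g \<in> topspace G. g n = a}"
    by (auto simp: topspace_odometer_iff)
  ultimately show ?thesis by simp
qed

text \<open>A basic open set of the product restricts finitely many coordinates. Since cylinders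
  around a point are nested, the one at the largest restricted index lies inside it.\<close>

lemma openin_odometer:
  "openin G S \<longleftrightarrow> S \<subseteq> topspace G \<and> (\<forall>g\<in>S. \<exists>n. cylinder p n g \<subseteq> S)"
proof
  assume S: "openin G S"
  show "S \<subseteq> topspace G \<and> (\<forall>g\<in>S. \<exists>n. cylinder p n g \<subseteq> S)"
  proof (intro conjI ballI)
    show "S \<subseteq> topspace G" using S by (rule openin_subset)
    fix g assume g: "g \<in> S"
    let ?P = "product_topology (\<lambda>n. discrete_topology {0..<int (p n)}) UNIV"
    obtain T where T: "openin ?P T" "S = T \<inter> topspace G"
      using S openin_subset[OF S] by (auto simp: odometer_def openin_subtopology)
    then obtain U where fin: "finite {i. U i \<noteq> {0..<int (p i)}}"
      and U: "g \<in> Pi\<^sub>E UNIV U" "Pi\<^sub>E UNIV U \<subseteq> T"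
      using g by (auto simp: openin_product_topology_alt)
    obtain n where n: "\<And>i. U i \<noteq> {0..<int (p i)} \<Longrightarrow> i \<le> n"
      using fin finite_nat_set_iff_bounded_le by auto
    have "h \<in> S" if h: "h \<in> cylinder p n g" for h
    proof -
      have "h i \<in> U i" for i
      proof (cases "U i = {0..<int (p i)}")
        case True
        then show ?thesis using h by (auto simp: cylinder_def topspace_odometer_iff)
      next
        case False
        then have "h \<in> cylinder p i g"
          using h n cylinder_mono g \<open>S \<subseteq> topspace G\<close> by blast
        then show ?thesis using U(1) by (auto simp: cylinder_def PiE_iff)
      qed
      then show ?thesis using T(2) U(2) h by (auto simp: cylinder_def PiE_iff)
    qed
    then show "\<exists>n. cylinder p n g \<subseteq> S" by blast
  qed
next
  assume S: "S \<subseteq> topspace G \<and> (\<forall>g\<in>S. \<exists>n. cylinder p n g \<subseteq> S)"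
  have "\<exists>T. openin G T \<and> g \<in> T \<and> T \<subseteq> S" if "g \<in> S" for g
  proof -
    from S that have "\<exists>n. cylinder p n g \<subseteq> S" by simp
    then obtain n where "cylinder p n g \<subseteq> S" ..
    moreover have "openin G (cylinder p n g)" unfolding cylinder_def by (rule openin_coordinate)
    moreover have "g \<in> cylinder p n g" using S that by (auto simp: cylinder_def)
    ultimately show ?thesis by blast
  qed
  then show "openin G S" by (subst openin_subopen) blast
qed

lemma openin_add_preimage:
  assumes "openin G U" "y \<in> topspace G"
  shows "openin G {g \<in> topspace G. od_add p g y \<in> U}"
  unfolding openin_odometer
proof (intro conjI ballI)
  fix g assume "g \<in> {g \<in> topspace G. od_add p g y \<in> U}"
  then obtain n where n: "cylinder p n (od_add p g y) \<subseteq> U"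
    using assms(1) openin_odometer by auto
  have "cylinder p n g \<subseteq> {g \<in> topspace G. od_add p g y \<in> U}"
    using n assms(2) add_in by (auto simp: cylinder_def od_add_def subset_iff)
  then show "\<exists>n. cylinder p n g \<subseteq> {g \<in> topspace G. od_add p g y \<in> U}" ..
qed auto

lemma openin_diff_preimage:
  assumes "openin G U" "y \<in> topspace G"
  shows "openin G {g \<in> topspace G. od_diff p g y \<in> U}"
  unfolding openin_odometer
proof (intro conjI ballI)
  fix g assume "g \<in> {g \<in> topspace G. od_diff p g y \<in> U}"
  then obtain n where n: "cylinder p n (od_diff p g y) \<subseteq> U"
    using assms(1) openin_odometer by auto
  have "cylinder p n g \<subseteq> {g \<in> topspace G. od_diff p g y \<in> U}"
    using n assms(2) diff_in by (auto simp: cylinder_def od_diff_def subset_iff)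
  then show "\<exists>n. cylinder p n g \<subseteq> {g \<in> topspace G. od_diff p g y \<in> U}" ..
qed auto

text \<open>Serves two windows: the points whose translates spell a given block, and those whose
  translates avoid the boundary.\<close>

lemma openin_translate_window:
  fixes I :: "int set" and U :: "int \<Rightarrow> (nat \<Rightarrow> int) set"
  assumes "finite I" "\<And>k. k \<in> I \<Longrightarrow> openin G (U k)"
  shows "openin G {g \<in> topspace G. \<forall>k\<in>I. translate k g \<in> U k}"
  using assms
proof (induction I rule: finite_induct)
  case (insert k I)
  have "openin G ({g \<in> topspace G. \<forall>k\<in>I. translate k g \<in> U k} \<inter>
      {g \<in> topspace G. translate k g \<in> U k})"
    using insert openin_add_preimage[OF _ Delta_in] by (intro openin_Int) (auto simp: translate_def)
  then show ?case by (rule back_subst[of "openin G"]) auto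
qed auto

end

section \<open>The boundary of the window\<close>

locale toeplitz = odometer_system p for p +
  fixes \<eta> :: "int \<Rightarrow> bool"
  assumes toeplitz: "\<And>k. \<exists>n. \<forall>j. \<eta> (k + int (p n) * j) = \<eta> k"
begin

abbreviation X where "X \<equiv> orbit_closure \<eta>"

text \<open>Eliminates the choice of \<open>k\<close> in the definition of \<open>V\<close>: the
  residue \<open>g n\<close> is itself a suitable representative.\<close>

lemma V_iff:
  "g \<in> V p \<eta> i \<longleftrightarrow> g \<in> topspace G \<and> (\<exists>n. \<forall>j. \<eta> (g n + int (p n) * j) = i)"
proof
  assume "g \<in> V p \<eta> i"
  then show "g \<in> topspace G \<and> (\<exists>n. \<forall>j. \<eta> (g n + int (p n) * j) = i)"
    by (force simp: V_def per_positions_def cylinder_def Delta_def)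
next
  assume "g \<in> topspace G \<and> (\<exists>n. \<forall>j. \<eta> (g n + int (p n) * j) = i)"
  then obtain n where g: "g \<in> topspace G" and n: "\<forall>j. \<eta> (g n + int (p n) * j) = i" by blast
  have "g n \<in> per_positions p \<eta> n i \<inter> {0..<int (p n)}"
    using g n by (auto simp: per_positions_def topspace_odometer_iff)
  moreover have "g \<in> cylinder p n (Delta p (g n))"
    using g by (simp add: cylinder_def Delta_def odometer_mod_self)
  ultimately show "g \<in> V p \<eta> i" unfolding V_def by blast
qed

lemma openin_V: "openin G (V p \<eta> i)"
  unfolding openin_odometer
proof (intro conjI ballI)
  fix g assume "g \<in> V p \<eta> i"
  then obtain n where "\<forall>j. \<eta> (g n + int (p n) * j) = i" by (auto simp: V_iff)
  then have "cylinder p n g \<subseteq> V p \<eta> i" by (auto simp: cylinder_def V_iff intro!: exI[of _ n])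
  then show "\<exists>n. cylinder p n g \<subseteq> V p \<eta> i" ..
qed (auto simp: V_iff)

text \<open>This is the Toeplitz property carried over to the odometer.\<close>

lemma Delta_in_V: "Delta p k \<in> V p \<eta> (\<eta> k)"
proof -
  obtain n where n: "\<And>j. \<eta> (k + int (p n) * j) = \<eta> k" using toeplitz by blast
  have "\<eta> (k mod int (p n) + int (p n) * j) = \<eta> k" for j
  proof -
    have "k mod int (p n) + int (p n) * j = k + int (p n) * (j - k div int (p n))"
      by (simp add: minus_div_mult_eq_mod[symmetric] algebra_simps)
    then show ?thesis using n by simp
  qed
  then show ?thesis using Delta_in[of k] by (auto simp: V_iff Delta_def)
qed

text \<open>At a common level \<open>N\<close> the position \<open>g N\<close> lies in both
  progressions on which \<eta> is constant, so \<open>\<eta> (g N)\<close> equals both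
  values.\<close>

lemma V_disjoint:
  assumes "g \<in> V p \<eta> i" "g \<in> V p \<eta> i'"
  shows "i = i'"
proof -
  have g: "g \<in> topspace G" using assms by (simp add: V_iff)
  obtain n n' where n: "\<forall>j. \<eta> (g n + int (p n) * j) = i" "\<forall>j. \<eta> (g n' + int (p n') * j) = i'"
    using assms unfolding V_iff by blast
  define N where "N = max n n'"
  have "g N = g k + int (p k) * (g N div int (p k))" if "k \<le> N" for k
    using odometer_mod[OF g that] mod_mult_div_eq[of "g N" "int (p k)"] by simp
  then obtain j j' where "g N = g n + int (p n) * j" "g N = g n' + int (p n') * j'"
    unfolding N_def using max.cobounded1 max.cobounded2 by blast
  then have "\<eta> (g N) = i" "\<eta> (g N) = i'" using n by (simp, metis)
  then show ?thesis by simp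
qed

text \<open>If \<open>g\<close> avoids the opposite set, every progression
  \<open>g n + p n * j\<close> contains a position where \<eta> equals \<open>i\<close>. Its image
  under \<open>Delta p\<close> lies in \<open>V p \<eta> i\<close> and in the cylinder of level
  \<open>n\<close> around \<open>g\<close>.\<close>

lemma closure_of_V: "G closure_of V p \<eta> i = topspace G - V p \<eta> (\<not> i)"
proof
  show "G closure_of V p \<eta> i \<subseteq> topspace G - V p \<eta> (\<not> i)"
  proof (rule closure_of_minimal)
    show "V p \<eta> i \<subseteq> topspace G - V p \<eta> (\<not> i)"
      using V_disjoint[of _ i "\<not> i"] openin_subset[OF openin_V] by auto
  qed (simp add: closedin_diff openin_V)
  show "topspace G - V p \<eta> (\<not> i) \<subseteq> G closure_of V p \<eta> i"
  proof
    fix g assume g: "g \<in> topspace G - V p \<eta> (\<not> i)"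
    have "\<exists>h. h \<in> V p \<eta> i \<and> h \<in> T" if T: "g \<in> T" "openin G T" for T
    proof -
      obtain n where n: "cylinder p n g \<subseteq> T" using T openin_odometer by blast
      obtain j where j: "\<eta> (g n + int (p n) * j) = i" using g by (auto simp: V_iff)
      have "Delta p (g n + int (p n) * j) \<in> cylinder p n g"
        using g Delta_in by (simp add: cylinder_def Delta_def odometer_mod_self)
      then show ?thesis using n j Delta_in_V by blast
    qed
    then show "g \<in> G closure_of V p \<eta> i" using g by (auto simp: in_closure_of)
  qed
qed

text \<open>The closure formula enters twice: once for \<open>W\<close>, and once, with the other
  symbol, for its interior.\<close>

lemma bdW_eq: "bdW p \<eta> = topspace G - (V p \<eta> True \<union> V p \<eta> False)"
proof -
  have W: "W p \<eta> = topspace G - V p \<eta> False" by (simp add: W_def closure_of_V)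
  have "G closure_of W p \<eta> = W p \<eta>" by (simp add: W_def)
  moreover have "G interior_of W p \<eta> = V p \<eta> True"
    unfolding W interior_of_complement closure_of_V using openin_V openin_subset by fastforce
  ultimately show ?thesis unfolding bdW_def frontier_of_def W by auto
qed

lemma not_in_bdW: "g \<in> topspace G \<Longrightarrow> g \<notin> bdW p \<eta> \<longleftrightarrow> (\<exists>i. g \<in> V p \<eta> i)"
  unfolding bdW_eq by (auto simp: ex_bool_eq)

lemma bdW_in_closure: "g \<in> bdW p \<eta> \<Longrightarrow> g \<in> G closure_of V p \<eta> i"
  unfolding closure_of_V bdW_eq by (cases i) auto

lemma bdW_meets_V:
  assumes "g \<in> bdW p \<eta>" "openin G T" "g \<in> T"
  shows "\<exists>h\<in>T. h \<in> V p \<eta> i"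
  using bdW_in_closure[OF assms(1), of i] assms(2,3) by (auto simp: in_closure_of)

lemma bdW_subset: "bdW p \<eta> \<subseteq> topspace G"
  by (auto simp: bdW_eq)

end

section \<open>The factor map and automorphisms\<close>

locale toeplitz_factor = toeplitz p \<eta> for p \<eta> +
  fixes \<pi> :: "(int \<Rightarrow> bool) \<Rightarrow> (nat \<Rightarrow> int)"
  assumes factor: "factor_map X shift G (od_rotation p) \<pi>"
    and base: "\<pi> \<eta> = Delta p 0"
begin

definition orbit :: "int \<Rightarrow> int \<Rightarrow> bool" where
  "orbit j = (\<lambda>k. \<eta> (k + j))"

lemma topspace_X: "topspace X = full_shift closure_of range orbit"
  using closure_of_subset_topspace[of full_shift]
  by (auto simp: orbit_closure_def orbit_def)

lemma orbit_in: "orbit j \<in> topspace X"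
  unfolding topspace_X
  by (rule subsetD[OF closure_of_subset]) (auto simp: full_shift_def)

text \<open>Lets relations that are locally constant on the orbit closure be checked on the orbit
  alone.\<close>

lemma orbit_dense:
  assumes "openin X U" "x \<in> U"
  shows "\<exists>j. orbit j \<in> U"
proof -
  obtain T where T: "openin full_shift T" "U = T \<inter> topspace X"
    using assms(1) openin_subset[OF assms(1)] unfolding orbit_closure_def openin_subtopology by auto
  then have "x \<in> full_shift closure_of range orbit" using assms(2) topspace_X by blast
  then obtain j where "orbit j \<in> T" using T assms(2) unfolding in_closure_of by blast
  then show ?thesis using T orbit_in by blast
qed

lemma compact_X: "compact_space X"
proof -
  have "compact_space full_shift" by (simp add: full_shift_def compact_space_product_topology compact_space_discrete_topology)
  then show ?thesis
    unfolding orbit_closure_def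
    by (intro compact_space_subtopology closedin_compact_space closedin_closure_of)
qed

lemma continuous_eval: "continuous_map X (discrete_topology UNIV) (\<lambda>x. x k)"
  unfolding orbit_closure_def full_shift_def by (intro continuous_intros) auto

lemma shift_orbit: "shift (orbit j) = orbit (j + 1)"
  by (simp add: shift_def orbit_def ac_simps)

section \<open>The factor map and its fibres\<close>

lemma factor_in: "x \<in> topspace X \<Longrightarrow> \<pi> x \<in> topspace G"
  using factor unfolding factor_map_def by blast

lemma factor_surj: "g \<in> topspace G \<Longrightarrow> \<exists>x\<in>topspace X. \<pi> x = g"
  using factor unfolding factor_map_def by (metis imageE)

lemma factor_shift: "x \<in> topspace X \<Longrightarrow> \<pi> (shift x) = translate 1 (\<pi> x)"
  using factor unfolding factor_map_def od_rotation_def translate_def by blast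

lemma factor_continuous: "continuous_map X G \<pi>"
  using factor unfolding factor_map_def by blast

text \<open>With \<open>F = id\<close> this concerns \<open>\<pi>\<close> itself, with an
  automorphism the composite \<open>\<pi> \<circ> F\<close>.\<close>

lemma openin_factor_coordinate:
  assumes "continuous_map X X F"
  shows "openin X {x \<in> topspace X. \<pi> (F x) n = a}"
proof -
  have "openin X {x \<in> topspace X. (\<pi> \<circ> F) x \<in> {g \<in> topspace G. g n = a}}"
    by (rule openin_continuous_map_preimage[OF continuous_map_compose[OF assms factor_continuous]
          openin_coordinate])
  then show ?thesis
    by (rule back_subst[of "openin X"])
      (use assms factor_in in \<open>auto simp: continuous_map_def Pi_iff\<close>)
qed

text \<open>Applied both to \<open>\<pi>\<close> and to \<open>\<pi> \<circ> F\<close>. Negative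
  times are reached by cancelling \<open>translate 1\<close>.\<close>

lemma equivariant_on_orbit:
  assumes in_G: "\<And>j. f (orbit j) \<in> topspace G"
    and shift: "\<And>j. f (shift (orbit j)) = translate 1 (f (orbit j))"
  shows "f (orbit j) = translate j (f (orbit 0))"
proof (induction j rule: int_induct[where k=0])
  case base
  show ?case using in_G by (simp add: translate_0)
next
  case (step1 j)
  then show ?case using shift[of j] by (simp add: shift_orbit translate_translate ac_simps)
next
  case (step2 j)
  have "translate 1 (f (orbit (j - 1))) = translate j (f (orbit 0))"
    using shift[of "j - 1"] step2 by (simp add: shift_orbit)
  then have "translate (- 1) (translate 1 (f (orbit (j - 1)))) = translate (- 1) (translate j (f (orbit 0)))"
    by simp
  then show ?case using in_G by (simp add: translate_translate translate_0)
qed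

lemma factor_orbit: "\<pi> (orbit j) = Delta p j"
proof -
  have "\<pi> (orbit j) = translate j (\<pi> (orbit 0))"
    by (rule equivariant_on_orbit) (simp_all add: factor_in orbit_in factor_shift)
  also have "\<pi> (orbit 0) = Delta p 0" by (simp add: orbit_def base)
  finally show ?thesis by (simp add: translate_def od_add_def Delta_def)
qed

text \<open>Some orbit point \<open>orbit j\<close> shares with \<open>x\<close> the entry at
  \<open>k\<close> and the factor coordinate at a level \<open>n\<close> witnessing
  \<open>V\<close>. That entry is \<open>\<eta> (k + j)\<close>, and \<open>k + j\<close> lies in a
  progression where \<eta> is constantly \<open>i\<close>.\<close>

lemma coordinate_of_fibre:
  assumes x: "x \<in> topspace X" and V: "translate k (\<pi> x) \<in> V p \<eta> i"
  shows "x k = i"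
proof -
  obtain n where n: "\<And>j. \<eta> ((\<pi> x n + k) mod int (p n) + int (p n) * j) = i"
    using V by (auto simp: V_iff translate_def od_add_def Delta_def mod_simps)
  have "openin X ({z \<in> topspace X. \<pi> (id z) n = \<pi> x n} \<inter> {z \<in> topspace X. z k \<in> {x k}})"
    by (intro openin_Int openin_factor_coordinate openin_continuous_map_preimage[OF continuous_eval]) auto
  then obtain j where j: "\<pi> (orbit j) n = \<pi> x n" "orbit j k = x k"
    using orbit_dense[where x=x] x by fastforce
  have "(\<pi> x n + k) mod int (p n) = (k + j) mod int (p n)"
    using j(1) by (simp add: factor_orbit Delta_def mod_simps ac_simps flip: j(1))
  then have "\<eta> (k + j) = i" using n[of "(k + j) div int (p n)"] by simp
  then show ?thesis using j(2) by (simp add: orbit_def)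
qed

text \<open>The image under \<open>\<pi>\<close> of the points with entry \<open>i\<close> at
  \<open>0\<close> is closed by compactness and contains \<open>V p \<eta> i\<close>, hence also its
  closure. Using both symbols, a fibre over the boundary has at least two points.\<close>

lemma fibre_over_bdW:
  assumes "Hausdorff_space G" "g \<in> bdW p \<eta>"
  shows "\<exists>x\<in>topspace X. \<pi> x = g \<and> x 0 = i"
proof -
  let ?C = "{x \<in> topspace X. x 0 \<in> {i}}"
  have "closedin X ?C"
    by (rule closedin_continuous_map_preimage[OF continuous_eval]) simp
  then have "closedin G (\<pi> ` ?C)"
    using continuous_imp_closed_map[OF factor_continuous compact_X assms(1)]
    by (auto simp: closed_map_def)
  moreover have "V p \<eta> i \<subseteq> \<pi> ` ?C"
  proof
    fix h assume h: "h \<in> V p \<eta> i"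
    then have "h \<in> topspace G" by (simp add: V_iff)
    then obtain x where "x \<in> topspace X" "\<pi> x = h" using factor_surj by blast
    moreover from this have "x 0 = i"
      using coordinate_of_fibre h \<open>h \<in> topspace G\<close> by (simp add: translate_0)
    ultimately show "h \<in> \<pi> ` ?C" by auto
  qed
  ultimately have "G closure_of V p \<eta> i \<subseteq> \<pi> ` ?C" by (simp add: closure_of_minimal)
  then show ?thesis using bdW_in_closure[OF assms(2)] by blast
qed

text \<open>On the orbit, \<open>\<pi> \<circ> F\<close> and \<open>\<pi>\<close> both advance by
  \<open>j\<close>, so their difference is constant. Density transfers this to \<open>x\<close>, one
  coordinate at a time.\<close>

lemma factor_automorphism:
  assumes aut: "automorphism \<eta> F" and x: "x \<in> topspace X"
  shows "\<pi> (F x) = od_add p (\<pi> x) (\<pi> (F \<eta>))"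
proof
  fix n
  have F: "continuous_map X X F" "\<And>x. x \<in> topspace X \<Longrightarrow> F (shift x) = shift (F x)"
    using aut by (auto simp: automorphism_def homeomorphic_map_def quotient_imp_continuous_map)
  then have F_in: "F z \<in> topspace X" if "z \<in> topspace X" for z
    using that by (auto simp: continuous_map_def)
  have orbit: "\<pi> (F (orbit j)) = translate j (\<pi> (F (orbit 0)))" for j
    by (rule equivariant_on_orbit[where f="\<lambda>x. \<pi> (F x)"])
      (simp_all add: factor_in F_in orbit_in F(2) factor_shift)
  have "openin X ({z \<in> topspace X. \<pi> (id z) n = \<pi> x n} \<inter> {z \<in> topspace X. \<pi> (F z) n = \<pi> (F x) n})"
    by (intro openin_Int openin_factor_coordinate F) auto
  then obtain j where j: "\<pi> (orbit j) n = \<pi> x n" "\<pi> (F (orbit j)) n = \<pi> (F x) n"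
    using orbit_dense[where x=x] x by fastforce
  have "\<pi> (F x) n = (\<pi> (F \<eta>) n + j) mod int (p n)"
    using j(2) orbit[of j] by (simp add: translate_def od_add_def Delta_def orbit_def mod_simps)
  then show "\<pi> (F x) n = od_add p (\<pi> x) (\<pi> (F \<eta>)) n"
    using j(1) by (simp add: factor_orbit od_add_def Delta_def mod_simps ac_simps flip: j(1))
qed

text \<open>Resolves the definite description: evaluating at \<eta>, which lies over the neutral
  element, forces the value.\<close>

lemma y_of_eq:
  assumes aut: "automorphism \<eta> F"
  shows "y_of p \<eta> \<pi> F = \<pi> (F \<eta>)"
  unfolding y_of_def
proof (rule the_equality)
  have \<eta>: "\<eta> \<in> topspace X" using orbit_in[of 0] by (simp add: orbit_def)
  then have "F \<eta> \<in> topspace X"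
    using aut homeomorphic_imp_surjective_map by (fastforce simp: automorphism_def)
  then show "\<pi> (F \<eta>) \<in> topspace G \<and> (\<forall>x\<in>topspace X. \<pi> (F x) = od_add p (\<pi> x) (\<pi> (F \<eta>)))"
    using factor_automorphism[OF aut] factor_in by blast
  fix y assume y: "y \<in> topspace G \<and> (\<forall>x\<in>topspace X. \<pi> (F x) = od_add p (\<pi> x) y)"
  then have "\<pi> (F \<eta>) = od_add p (Delta p 0) y" using \<eta> base by simp
  then show "y = \<pi> (F \<eta>)" using y by (simp add: od_add_def Delta_def odometer_mod_self)
qed

text \<open>The inclusion for the inverse of \<open>F\<close>: if the whole window around
  \<open>g\<close> avoids the boundary, the code has a locally constant output near
  \<open>g\<close>, which cannot happen below a boundary point.\<close>

lemma bdW_of_rotated: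
  assumes code: "described_by_block_code \<eta> F m c"
    and y: "y \<in> topspace G"
    and F: "\<And>x. x \<in> topspace X \<Longrightarrow> F x \<in> topspace X"
    and rot: "\<And>x. x \<in> topspace X \<Longrightarrow> \<pi> (F x) = od_add p (\<pi> x) y"
    and g: "g \<in> topspace G" "od_add p g y \<in> bdW p \<eta>"
  shows "\<exists>k\<in>{- int m..int m}. translate k g \<in> bdW p \<eta>"
proof (rule ccontr)
  let ?I = "{- int m..int m}"
  assume "\<not> ?thesis"
  then have "\<forall>k\<in>?I. \<exists>i. translate k g \<in> V p \<eta> i" using g(1) not_in_bdW translate_in by blast
  then obtain b where b: "\<And>k. k \<in> ?I \<Longrightarrow> translate k g \<in> V p \<eta> (b k)" by metis
  \<comment> \<open>Over \<open>U\<close> every fibre point carries the block \<open>b\<close> on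
    the window.\<close>
  define U where "U = {h \<in> topspace G. \<forall>k\<in>?I. translate k h \<in> V p \<eta> (b k)}"
  have "openin G U" unfolding U_def by (intro openin_translate_window openin_V) auto
  then have "openin G {h \<in> topspace G. od_diff p h y \<in> U}" using y by (rule openin_diff_preimage)
  moreover have "g \<in> U" using g(1) b by (simp add: U_def)
  then have "od_add p g y \<in> {h \<in> topspace G. od_diff p h y \<in> U}"
    using g(1) y by (simp add: add_in diff_add)
  \<comment> \<open>The symbol is chosen opposite to the output of the code on \<open>b\<close>; the
    boundary point \<open>od_add p g y\<close> is approximated by \<open>V\<close> of either
    symbol.\<close>
  ultimately have "\<exists>h\<in>{h \<in> topspace G. od_diff p h y \<in> U}. h \<in> V p \<eta> (\<not> c (restrict b ?I))"
    by (rule bdW_meets_V[OF g(2)])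
  then obtain h where h: "h \<in> V p \<eta> (\<not> c (restrict b ?I))" "h \<in> topspace G" "od_diff p h y \<in> U"
    by auto
  obtain x where x: "x \<in> topspace X" "\<pi> x = od_diff p h y"
    using factor_surj diff_in h(2) y by blast
  have "x k = b k" if "k \<in> ?I" for k
    using coordinate_of_fibre[OF x(1)] h(3) that x(2) by (auto simp: U_def)
  then have "restrict (\<lambda>i. x (0 + i)) ?I = restrict b ?I" by (auto simp: restrict_def)
  then have "F x 0 = c (restrict b ?I)" using code x(1) by (simp add: described_by_block_code_def)
  moreover have "translate 0 (\<pi> (F x)) = h" using rot x h(2) by (simp add: add_diff translate_0)
  then have "F x 0 = (\<not> c (restrict b ?I))" using coordinate_of_fibre F x(1) h(1) by simp
  ultimately show False by simp
qed

text \<open>If all translates of \<open>od_add p g y\<close> avoid the boundary, every entry of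
  \<open>F x\<close> is determined for \<open>x\<close> over \<open>g\<close>, so \<open>F\<close>
  collapses a fibre with two points. Since the entire sequence matters, no bound on \<open>k\<close>
  results.\<close>

lemma rotated_of_bdW:
  assumes "Hausdorff_space G"
    and inj: "inj_on F (topspace X)"
    and y: "y \<in> topspace G"
    and F: "\<And>x. x \<in> topspace X \<Longrightarrow> F x \<in> topspace X"
    and rot: "\<And>x. x \<in> topspace X \<Longrightarrow> \<pi> (F x) = od_add p (\<pi> x) y"
    and g: "g \<in> bdW p \<eta>"
  shows "\<exists>k. translate k (od_add p g y) \<in> bdW p \<eta>"
proof (rule ccontr)
  assume "\<not> ?thesis"
  moreover have "od_add p g y \<in> topspace G" using g bdW_subset y add_in by blast
  ultimately have "\<forall>k. \<exists>i. translate k (od_add p g y) \<in> V p \<eta> i" using not_in_bdW translate_in by blast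
  then obtain b where b: "\<And>k. translate k (od_add p g y) \<in> V p \<eta> (b k)" by metis
  have "F x = b" if "x \<in> topspace X" "\<pi> x = g" for x
    using coordinate_of_fibre[OF F[OF that(1)]] rot[OF that(1)] that(2) b by auto
  moreover obtain x x' where "x \<in> topspace X" "\<pi> x = g" "x 0 = True"
    "x' \<in> topspace X" "\<pi> x' = g" "x' 0 = False"
    using fibre_over_bdW[OF assms(1) g] by metis
  ultimately show False using inj by (metis inj_onD)
qed

end

section \<open>The Baire category argument\<close>

text \<open>Baire's theorem is applied to the closures, which are closed with empty
  interior.\<close>

lemma openin_nowhere_dense_cover_empty:
  assumes X: "compact_space X" "Hausdorff_space X"
    and \<N>: "countable \<N>" "\<And>N. N \<in> \<N> \<Longrightarrow> nowhere_dense_in X N"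
    and D: "openin X D" "D \<subseteq> \<Union>\<N>"
  shows "D = {}"
proof -
  have "X interior_of \<Union>((closure_of) X ` \<N>) = {}"
  proof (rule Baire_category_alt)
    show "completely_metrizable_space X \<or> locally_compact_space X \<and> regular_space X"
      using X compact_Hausdorff_imp_regular_space compact_imp_locally_compact_space by blast
  qed (use \<N> in \<open>auto simp: nowhere_dense_in_def\<close>)
  moreover have "D \<subseteq> \<Union>((closure_of) X ` \<N>)"
  proof
    fix x assume x: "x \<in> D"
    then obtain N where "N \<in> \<N>" "x \<in> N" using D(2) by blast
    moreover have "x \<in> topspace X" using x openin_subset[OF D(1)] by blast
    ultimately show "x \<in> \<Union>((closure_of) X ` \<N>)" by (auto simp: in_closure_of)
  qed
  ultimately show ?thesis using D(1) interior_of_maximal by blast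
qed

theorem proposition2p12:
  fixes p :: "nat \<Rightarrow> nat"
    and \<eta> :: "int \<Rightarrow> bool"
    and \<pi> :: "(int \<Rightarrow> bool) \<Rightarrow> (nat \<Rightarrow> int)"
    and F :: "(int \<Rightarrow> bool) \<Rightarrow> (int \<Rightarrow> bool)"
    and m :: nat
    and c :: "(int \<Rightarrow> bool) \<Rightarrow> bool"
  assumes toeplitz: "nonperiodic_Toeplitz p \<eta>"
    and mef: "maximal_equicontinuous_factor (orbit_closure \<eta>) shift (odometer p) (od_rotation p) \<pi>"
    and base: "\<pi> \<eta> = Delta p 0"
    and nwd: "\<And>k::int. k \<noteq> 0 \<Longrightarrow>
      nowhere_dense_in (subtopology (odometer p) (bdW p \<eta>))
        (bdW p \<eta> \<inter> (\<lambda>g. od_diff p g (Delta p k)) ` bdW p \<eta>)"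
    and aut: "automorphism \<eta> F"
    and code: "described_by_block_code \<eta> F m c"
  shows "(\<lambda>g. od_add p g (y_of p \<eta> \<pi> F)) ` bdW p \<eta>
    \<subseteq> (\<Union>k\<in>{- int m..int m}. (\<lambda>g. od_add p g (Delta p k)) ` bdW p \<eta>)"
proof -
  interpret toeplitz_factor p \<eta> \<pi>
    by unfold_locales
      (use toeplitz mef base in \<open>auto simp: nonperiodic_Toeplitz_def maximal_equicontinuous_factor_def\<close>)
  let ?B = "bdW p \<eta>" and ?I = "{- int m..int m}"
  let ?T = "subtopology G ?B"
  define y where "y = y_of p \<eta> \<pi> F"
  have F: "F x \<in> topspace X" if "x \<in> topspace X" for x
    using aut that homeomorphic_imp_surjective_map by (fastforce simp: automorphism_def)
  have inj: "inj_on F (topspace X)"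
    using aut homeomorphic_imp_injective_map by (auto simp: automorphism_def)
  have "\<eta> \<in> topspace X" using orbit_in[of 0] by (simp add: orbit_def)
  then have y: "y \<in> topspace G" using F factor_in by (simp add: y_def y_of_eq[OF aut])
  have rot: "\<pi> (F x) = od_add p (\<pi> x) y" if "x \<in> topspace X" for x
    using factor_automorphism[OF aut that] by (simp add: y_def y_of_eq[OF aut])
  \<comment> \<open>Both are read off from equicontinuity of the factor, which includes compactness
    and a metric inducing the topology.\<close>
  have G: "compact_space G" "Hausdorff_space G"
    using mef Metric_space.Hausdorff_space_mtopology
    unfolding maximal_equicontinuous_factor_def equicontinuous_system_def by (blast, metis)

  \<comment> \<open>The boundary points violating the claim; moving the translation to the other
    side only changes the sign of \<open>k\<close>, and the window is symmetric.\<close>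
  define D where "D = {g \<in> ?B. \<forall>k\<in>?I. translate k (od_add p g y) \<notin> ?B}"
  have "D = {}"
  proof (rule openin_nowhere_dense_cover_empty)
    have "closedin G ?B" by (simp add: bdW_def closedin_frontier_of)
    then show "compact_space ?T"
      using G(1) closedin_compact_space compact_space_subtopology by blast
    show "Hausdorff_space ?T" using G(2) by (rule Hausdorff_space_subtopology)
    let ?N = "\<lambda>k. ?B \<inter> (\<lambda>g. od_diff p g (Delta p k)) ` ?B"
    show "countable (?N ` (UNIV - {0}))" by simp
    show "nowhere_dense_in ?T N" if "N \<in> ?N ` (UNIV - {0})" for N using that nwd by blast
    \<comment> \<open>The window is finite and the boundary closed, so avoiding the boundary
      throughout the window is an open condition.\<close>
    have "openin G {g \<in> topspace G. od_add p g y \<in>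
        {h \<in> topspace G. \<forall>k\<in>?I. translate k h \<in> topspace G - ?B}}"
      using y \<open>closedin G ?B\<close> by (intro openin_add_preimage openin_translate_window) auto
    moreover have "D = {g \<in> topspace G. od_add p g y \<in>
        {h \<in> topspace G. \<forall>k\<in>?I. translate k h \<in> topspace G - ?B}} \<inter> ?B"
      using bdW_subset y add_in translate_in by (auto simp: D_def subset_iff)
    ultimately show "openin ?T D" unfolding openin_subtopology by blast
    show "D \<subseteq> \<Union>(?N ` (UNIV - {0}))"
    proof
      fix g assume "g \<in> D"
      then have g: "g \<in> ?B" "g \<in> topspace G" and gD: "\<forall>k\<in>?I. translate k (od_add p g y) \<notin> ?B"
        using bdW_subset by (auto simp: D_def)
      obtain k where k: "translate k (od_add p g y) \<in> ?B"
        using rotated_of_bdW[OF G(2) inj y F rot g(1)] by blast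
      \<comment> \<open>As translation commutes with adding \<open>y\<close>, the point
        \<open>translate k g\<close> rotated by \<open>y\<close> is on the boundary, and the code
        bound applies to it.\<close>
      then obtain j where j: "j \<in> ?I" "translate j (translate k g) \<in> ?B"
        using bdW_of_rotated[OF code y F rot, of "translate k g"] g(2) translate_in translate_add
        by metis
      have "k \<notin> ?I" using gD k by blast
      \<comment> \<open>Otherwise \<open>k = - j\<close> would lie in the symmetric window.\<close>
      then have "j + k \<noteq> 0" using j(1) by auto
      moreover have "g = od_diff p (translate (j + k) g) (Delta p (j + k))"
        using g(2) by (simp add: diff_Delta translate_translate translate_0)
      then have "g \<in> ?N (j + k)" using g(1) j(2) by (auto simp: translate_translate)
      ultimately show "g \<in> \<Union>(?N ` (UNIV - {0}))" by blast
    qed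
  qed
  show ?thesis
  proof safe
    fix g assume g: "g \<in> ?B"
    then obtain k where k: "k \<in> ?I" "translate k (od_add p g y) \<in> ?B"
      using \<open>D = {}\<close> by (auto simp: D_def)
    have "od_add p g y \<in> topspace G" using g y bdW_subset add_in by blast
    \<comment> \<open>Undoing the translation by \<open>k\<close> exhibits the point as a boundary
      point shifted by \<open>- k\<close>.\<close>
    then have "od_add p g y = od_add p (translate k (od_add p g y)) (Delta p (- k))"
      using translate_translate[of "- k" k] by (simp add: translate_0 flip: translate_def)
    moreover have "- k \<in> ?I" using k(1) by auto
    ultimately show "od_add p g (y_of p \<eta> \<pi> F) \<in> (\<Union>k\<in>?I. (\<lambda>g. od_add p g (Delta p k)) ` ?B)"
      using k(2) unfolding y_def by blast
  qed
qed

end
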